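(* Let $G$ be a countable (discrete) amenable group, let $X$ be a compact metric space with metric $d$, and let $\mathbf{F}=\{F_{g,\omega}:\mathcal{E}_{\omega}\rightarrow\mathcal{E}_{g\omega}\mid g\in G,\ \omega\in\Omega\}$ be a continuous bundle random dynamical system over a measurable dynamical $G$-system $(\Omega,\mathcal{F},\mathbb{P},G)$, with $\mathcal{E}\subseteq\Omega\times X$ and fibers $\mathcal{E}_\omega\subseteq X$. Suppose that $\Omega$ is finite and that the skew product transformation $G\curvearrowright\mathcal{E}$, $g(\omega,x)=(g\omega,F_{g,\omega}x)$, is minimal. Then $\mathbf{F}$ is either Weyl-mean equicontinuous or Weyl-mean sensitive.
   Context: Measurable dynamical system: $(\Omega,\mathcal{F},\mathbb{P})$ is a Lebesgue probability space (in particular complete and countably separated) on which $G$ acts by invertible measure-preserving transformations, with the identity $e_G$ acting as the identity map. Continuous bundle random dynamical system (RDS): $X$ is a compact metric space with metric $d$ and Borel $\sigma$-algebra $\mathcal{B}_X$; $\mathcal{E}\in\mathcal{F}\times\mathcal{B}_X$ (product $\sigma$-algebra) and $\mathcal{E}_\omega=\{x\in X:(\omega,x)\in\mathcal{E}\}$. A family of maps $\mathbf{F}=\{F_{g,\omega}:\mathcal{E}_\omega\to\mathcal{E}_{g\omega}\mid g\in G,\omega\in\Omega\}$ is an RDS over $(\Omega,\mathcal{F},\mathbb{P},G)$ if (1) $F_{e_G,\omega}$ is the identity of $\mathcal{E}_\omega$ for each $\omega$; (2) for each $g\in G$ the map $\mathcal{E}\to X$, $(\omega,x)\mapsto F_{g,\omega}(x)$,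 is measurable; (3) $F_{g_2,g_1\omega}\circ F_{g_1,\omega}=F_{g_2g_1,\omega}$ for all $\omega\in\Omega$, $g_1,g_2\in G$. It is continuous if for $\mathbb{P}$-a.e. $\omega\in\Omega$ the set $\mathcal{E}_\omega$ is a nonempty compact subset of $X$ and $F_{g,\omega}$ is continuous for each $g\in G$. Minimality: an action of $G$ on a topological space is minimal if the space has no nonempty proper closed $G$-invariant subset. Here $\mathcal{E}$ carries the subspace topology from $\Omega\times X$, where the finite set $\Omega$ is discrete. A Følner sequence of $G$ is a (left) Følner sequence: a sequence $\{F_n\}_{n\in\mathbb{N}}$ of nonempty finite subsets of $G$ with $|tF_n\triangle F_n|/|F_n|\to 0$ for every $t\in G$. Weyl-mean equicontinuity: for $t\in G$ and $x,y\in X$ such that $x,y\in\mathcal{E}_\omega$ for some $\omega\in\Omega$, put $$\widetilde{d}(tx,ty)=\sup\{d(F_{t,\omega}x,F_{t,\omega}y):\ \omega\in\Omega,\ x,y\in\mathcal{E}_\omega\}$$ (a function of the triple $(t,x,y)$), and $$D^{(r)}(x,y)=\sup_{\{F_n\}}\limsup_{n\to\infty}\frac{1}{|F_n|}\sum_{t\in F_n}\widetilde{d}(tx,ty),$$ the supremum being over all Følner sequences $\{F_n\}$ of $G$. $\mathbf{F}$ is Weyl-mean equicontinuous if for every $\varepsilon>0$ there is $\delta>0$ such that $D^{(r)}(x,y)<\varepsilon$ whenever $x,y\in\mathcal{E}_\omega$ for some $\omega\in\Omega$ and $d(x,y)<\delta$. Weyl-mean sensitivity: for $\omega\in\Omega$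 and $x,y\in\mathcal{E}_\omega$ put $$\hat{D}^{(r)}_{\omega}(x,y)=\sup_{\{F_n\}}\limsup_{n\to\infty}\frac{1}{|F_n|}\sum_{t\in F_n}d(F_{t,\omega}x,F_{t,\omega}y),$$ the supremum being over all Følner sequences $\{F_n\}$ of $G$; if $x,y$ do not both belong to $\mathcal{E}_\omega$, put $\hat{D}^{(r)}_\omega(x,y)=\infty$. $\mathbf{F}$ is Weyl-mean sensitive if there exists $\delta>0$ such that for every $x\in\bigcup_{\omega\in\Omega}\mathcal{E}_\omega$ and every $\varepsilon>0$ there are $\omega\in\Omega$ and $y\in\mathcal{E}_\omega\cap B(x,\varepsilon)$ with $\hat{D}^{(r)}_\omega(x,y)>\delta$, where $B(x,\varepsilon)$ is the open ball of radius $\varepsilon$ about $x$ in $X$. *)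

theory Defs
  imports "HOL-Probability.Probability" "HOL-Algebra.Group_Action"
begin

section \<open>Amenability and Folner sequences\<close>

text \<open>Amenability of a discrete group in von Neumann's sense: a finitely additive,
  left-invariant probability measure on all subsets of the group.\<close>

definition amenable :: "('g, 'm) monoid_scheme \<Rightarrow> bool" where
  "amenable G \<longleftrightarrow>
     (\<exists>\<mu> :: 'g set \<Rightarrow> real.
        \<mu> (carrier G) = 1 \<and>
        (\<forall>A. A \<subseteq> carrier G \<longrightarrow> 0 \<le> \<mu> A) \<and>
        (\<forall>A B. A \<subseteq> carrier G \<longrightarrow> B \<subseteq> carrier G \<longrightarrow> A \<inter> B = {} \<longrightarrow> \<mu> (A \<union> B) = \<mu> A + \<mu> B) \<and>
        (\<forall>g\<in>carrier G. \<forall>A. A \<subseteq> carrier G \<longrightarrow> \<mu> (g <#\<^bsub>G\<^esub> A) = \<mu> A))"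

definition Folner_seq :: "('g, 'm) monoid_scheme \<Rightarrow> (nat \<Rightarrow> 'g set) \<Rightarrow> bool" where
  "Folner_seq G Fs \<longleftrightarrow>
     (\<forall>n. finite (Fs n) \<and> Fs n \<noteq> {} \<and> Fs n \<subseteq> carrier G) \<and>
     (\<forall>t\<in>carrier G.
        (\<lambda>n. real (card (sym_diff (t <#\<^bsub>G\<^esub> Fs n) (Fs n))) / real (card (Fs n))) \<longlonglongrightarrow> 0)"

section \<open>Measurable dynamical systems\<close>

definition countably_separated :: "'w measure \<Rightarrow> bool" where
  "countably_separated M \<longleftrightarrow>
     (\<exists>\<C>. countable \<C> \<and> \<C> \<subseteq> sets M \<and>
        (\<forall>x\<in>space M. \<forall>y\<in>space M. x \<noteq> y \<longrightarrow> (\<exists>C\<in>\<C>. x \<in> C \<longleftrightarrow> y \<notin> C)))"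

definition isomorphic_mod_0 :: "'a measure \<Rightarrow> 'b measure \<Rightarrow> bool" where
  "isomorphic_mod_0 M N \<longleftrightarrow>
     (\<exists>A\<in>null_sets M. \<exists>B\<in>null_sets N. \<exists>f h.
        let M' = restrict_space M (space M - A); N' = restrict_space N (space N - B) in
          f \<in> M' \<rightarrow>\<^sub>M N' \<and> h \<in> N' \<rightarrow>\<^sub>M M' \<and>
          (\<forall>x\<in>space M'. h (f x) = x) \<and> (\<forall>y\<in>space N'. f (h y) = y) \<and>
          distr M' N' f = N')"

text \<open>Lebesgue (standard) probability spaces: isomorphic modulo null sets to the completion of a
  Borel probability measure on a Polish space. As every Polish space is Borel isomorphic to a Borel
  subset of the real line, it suffices to consider Borel probability measures on the line.\<close>

definition lebesgue_prob_space :: "'w measure \<Rightarrow> bool" where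
  "lebesgue_prob_space M \<longleftrightarrow>
     prob_space M \<and> complete_measure M \<and> countably_separated M \<and>
     (\<exists>\<nu> :: real measure. prob_space \<nu> \<and> sets \<nu> = sets borel \<and> isomorphic_mod_0 M (completion \<nu>))"

text \<open>Invertibility of the transformations, and the neutral element acting as the identity, are part
  of \<open>group_action\<close>, which makes \<open>act\<close> a homomorphism into the bijections of the space.\<close>

locale measurable_dynamical_system = group_action G "space M" act
  for G :: "('g, 'm) monoid_scheme" (structure)
    and M :: "'w measure" and act :: "'g \<Rightarrow> 'w \<Rightarrow> 'w" +
  assumes lebesgue: "lebesgue_prob_space M"
    and measurable_act: "g \<in> carrier G \<Longrightarrow> act g \<in> M \<rightarrow>\<^sub>M M"
    and measure_preserving: "g \<in> carrier G \<Longrightarrow> distr M M (act g) = M"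

section \<open>Continuous bundle random dynamical systems\<close>

definition fiber :: "('w \<times> 'x) set \<Rightarrow> 'w \<Rightarrow> 'x set" where
  "fiber E \<omega> = {x. (\<omega>, x) \<in> E}"

text \<open>The compact metric space \<open>X\<close> is a type. The value \<open>F g \<omega> x\<close> is only meaningful
  for \<open>x \<in> fiber E \<omega>\<close>.\<close>

locale bundle_RDS = measurable_dynamical_system G M act
  for G :: "('g, 'm) monoid_scheme" (structure)
    and M :: "'w measure" and act :: "'g \<Rightarrow> 'w \<Rightarrow> 'w" +
  fixes E :: "('w \<times> 'x::metric_space) set"
    and F :: "'g \<Rightarrow> 'w \<Rightarrow> 'x \<Rightarrow> 'x"
  assumes compact_X: "compact (UNIV :: 'x set)"
    and E_sets: "E \<in> sets (M \<Otimes>\<^sub>M borel)"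
    and F_fiber: "\<lbrakk>g \<in> carrier G; \<omega> \<in> space M; x \<in> fiber E \<omega>\<rbrakk>
                    \<Longrightarrow> F g \<omega> x \<in> fiber E (act g \<omega>)"
    and F_one: "\<lbrakk>\<omega> \<in> space M; x \<in> fiber E \<omega>\<rbrakk> \<Longrightarrow> F \<one> \<omega> x = x"
    and F_measurable: "g \<in> carrier G
                    \<Longrightarrow> (\<lambda>(\<omega>, x). F g \<omega> x) \<in> restrict_space (M \<Otimes>\<^sub>M borel) E \<rightarrow>\<^sub>M borel"
    and F_cocycle: "\<lbrakk>g\<^sub>1 \<in> carrier G; g\<^sub>2 \<in> carrier G; \<omega> \<in> space M; x \<in> fiber E \<omega>\<rbrakk>
                    \<Longrightarrow> F g\<^sub>2 (act g\<^sub>1 \<omega>) (F g\<^sub>1 \<omega> x) = F (g\<^sub>2 \<otimes> g\<^sub>1) \<omega> x"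

locale continuous_bundle_RDS = bundle_RDS G M act E F
  for G :: "('g, 'm) monoid_scheme" (structure)
    and M :: "'w measure" and act :: "'g \<Rightarrow> 'w \<Rightarrow> 'w"
    and E :: "('w \<times> 'x::metric_space) set"
    and F :: "'g \<Rightarrow> 'w \<Rightarrow> 'x \<Rightarrow> 'x" +
  assumes AE_continuous:
    "AE \<omega> in M. fiber E \<omega> \<noteq> {} \<and> compact (fiber E \<omega>) \<and>
                (\<forall>g\<in>carrier G. continuous_on (fiber E \<omega>) (F g \<omega>))"

definition skew_product :: "('g \<Rightarrow> 'w \<Rightarrow> 'w) \<Rightarrow> ('g \<Rightarrow> 'w \<Rightarrow> 'x \<Rightarrow> 'x) \<Rightarrow> 'g \<Rightarrow> 'w \<times> 'x \<Rightarrow> 'w \<times> 'x" where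
  "skew_product act F g = (\<lambda>(\<omega>, x). (act g \<omega>, F g \<omega> x))"

definition minimal_action :: "('g, 'm) monoid_scheme \<Rightarrow> 'a topology \<Rightarrow> ('g \<Rightarrow> 'a \<Rightarrow> 'a) \<Rightarrow> bool" where
  "minimal_action G T \<phi> \<longleftrightarrow>
     \<not> (\<exists>A. A \<noteq> {} \<and> A \<noteq> topspace T \<and> closedin T A \<and> (\<forall>g\<in>carrier G. \<phi> g ` A \<subseteq> A))"

definition bundle_topology :: "'w measure \<Rightarrow> ('w \<times> 'x::topological_space) set \<Rightarrow> ('w \<times> 'x) topology" where
  "bundle_topology M E = subtopology (prod_topology (discrete_topology (space M)) euclidean) E"

section \<open>Weyl-mean equicontinuity and sensitivity\<close>

definition dtilde ::
  "'w measure \<Rightarrow> ('w \<times> 'x::metric_space) set \<Rightarrow> ('g \<Rightarrow> 'w \<Rightarrow> 'x \<Rightarrow> 'x) \<Rightarrow> 'g \<Rightarrow> 'x \<Rightarrow> 'x \<Rightarrow> real" where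
  "dtilde M E F t x y =
     Sup {dist (F t \<omega> x) (F t \<omega> y) | \<omega>. \<omega> \<in> space M \<and> x \<in> fiber E \<omega> \<and> y \<in> fiber E \<omega>}"

definition Weyl_D ::
  "('g, 'm) monoid_scheme \<Rightarrow> 'w measure \<Rightarrow> ('w \<times> 'x::metric_space) set \<Rightarrow>
   ('g \<Rightarrow> 'w \<Rightarrow> 'x \<Rightarrow> 'x) \<Rightarrow> 'x \<Rightarrow> 'x \<Rightarrow> ereal" where
  "Weyl_D G M E F x y =
     (SUP Fs\<in>{Fs. Folner_seq G Fs}.
        limsup (\<lambda>n. ereal ((1 / real (card (Fs n))) * (\<Sum>t\<in>Fs n. dtilde M E F t x y))))"

definition Weyl_mean_equicontinuous ::
  "('g, 'm) monoid_scheme \<Rightarrow> 'w measure \<Rightarrow> ('w \<times> 'x::metric_space) set \<Rightarrow>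
   ('g \<Rightarrow> 'w \<Rightarrow> 'x \<Rightarrow> 'x) \<Rightarrow> bool" where
  "Weyl_mean_equicontinuous G M E F \<longleftrightarrow>
     (\<forall>\<epsilon>>0. \<exists>\<delta>>0. \<forall>x y. (\<exists>\<omega>\<in>space M. x \<in> fiber E \<omega> \<and> y \<in> fiber E \<omega>) \<and> dist x y < \<delta>
        \<longrightarrow> Weyl_D G M E F x y < ereal \<epsilon>)"

definition Weyl_Dhat ::
  "('g, 'm) monoid_scheme \<Rightarrow> ('w \<times> 'x::metric_space) set \<Rightarrow>
   ('g \<Rightarrow> 'w \<Rightarrow> 'x \<Rightarrow> 'x) \<Rightarrow> 'w \<Rightarrow> 'x \<Rightarrow> 'x \<Rightarrow> ereal" where
  "Weyl_Dhat G E F \<omega> x y =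
     (if x \<in> fiber E \<omega> \<and> y \<in> fiber E \<omega>
      then SUP Fs\<in>{Fs. Folner_seq G Fs}.
             limsup (\<lambda>n. ereal ((1 / real (card (Fs n))) * (\<Sum>t\<in>Fs n. dist (F t \<omega> x) (F t \<omega> y))))
      else \<infinity>)"

definition Weyl_mean_sensitive ::
  "('g, 'm) monoid_scheme \<Rightarrow> 'w measure \<Rightarrow> ('w \<times> 'x::metric_space) set \<Rightarrow>
   ('g \<Rightarrow> 'w \<Rightarrow> 'x \<Rightarrow> 'x) \<Rightarrow> bool" where
  "Weyl_mean_sensitive G M E F \<longleftrightarrow>
     (\<exists>\<delta>>0. \<forall>x\<in>(\<Union>\<omega>\<in>space M. fiber E \<omega>). \<forall>\<epsilon>>0.
        \<exists>\<omega>\<in>space M. \<exists>y\<in>fiber E \<omega> \<inter> ball x \<epsilon>. Weyl_Dhat G E F \<omega> x y > ereal \<delta>)"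

end

theory Submission
  imports Defs
begin

text \<open>Minimality moves every point of the bundle into any prescribed relatively open piece of a
  fiber. If the system is not sensitive, there is a piece on which the pseudometrics
  \<open>Weyl_Dhat\<close> are small. A right translate of a left Folner sequence is again one, so these
  pseudometrics are invariant under the action; smallness thus pulls back to a neighbourhood of every
  point, and compactness of the finitely many fibers makes it uniform. Finally \<open>Weyl_D\<close> is at
  most the sum of the \<open>Weyl_Dhat\<close> over the finitely many base points.\<close>

section \<open>Upper Weyl means: monotonicity, subadditivity, right invariance\<close>

definition upper_Weyl_mean :: "('g, 'm) monoid_scheme \<Rightarrow> ('g \<Rightarrow> real) \<Rightarrow> ereal" where
  "upper_Weyl_mean G f =
     (SUP Fs\<in>{Fs. Folner_seq G Fs}.
        limsup (\<lambda>n. ereal ((1 / real (card (Fs n))) * (\<Sum>t\<in>Fs n. f t))))"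

lemma upper_Weyl_mean_mono:
  assumes "\<And>t. t \<in> carrier G \<Longrightarrow> f t \<le> g t"
  shows "upper_Weyl_mean G f \<le> upper_Weyl_mean G g"
  unfolding upper_Weyl_mean_def
proof (rule SUP_mono, clarify)
  fix Fs :: "nat \<Rightarrow> 'a set"
  assume Fs: "Folner_seq G Fs"
  then have "sum f (Fs n) \<le> sum g (Fs n)" for n
    by (intro sum_mono assms) (auto simp: Folner_seq_def)
  then have "limsup (\<lambda>n. ereal (1 / real (card (Fs n)) * sum f (Fs n)))
      \<le> limsup (\<lambda>n. ereal (1 / real (card (Fs n)) * sum g (Fs n)))"
    by (intro Limsup_mono always_eventually allI) (simp add: divide_right_mono)
  with Fs show "\<exists>Fs'\<in>{Fs. Folner_seq G Fs}.
      limsup (\<lambda>n. ereal (1 / real (card (Fs n)) * sum f (Fs n)))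
      \<le> limsup (\<lambda>n. ereal (1 / real (card (Fs' n)) * sum g (Fs' n)))"
    by blast
qed

lemma upper_Weyl_mean_add:
  "upper_Weyl_mean G (\<lambda>t. f t + g t) \<le> upper_Weyl_mean G f + upper_Weyl_mean G g"
  unfolding upper_Weyl_mean_def
proof (rule SUP_least)
  fix Fs :: "nat \<Rightarrow> 'a set"
  assume Fs: "Fs \<in> {Fs. Folner_seq G Fs}"
  let ?a = "\<lambda>f n. ereal (1 / real (card (Fs n)) * sum f (Fs n))"
  have "limsup (?a (\<lambda>t. f t + g t)) = limsup (\<lambda>n. ?a f n + ?a g n)"
    by (simp add: sum.distrib add_divide_distrib)
  \<comment> \<open>In \<open>ereal\<close>, infinity plus minus infinity is infinity, so this
    subadditivity also covers unbounded \<open>f\<close> and \<open>g\<close>.\<close>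
  also have "\<dots> \<le> limsup (?a f) + limsup (?a g)"
    by (rule ereal_limsup_add_mono)
  also have "\<dots> \<le> (SUP Fs\<in>{Fs. Folner_seq G Fs}.
        limsup (\<lambda>n. ereal ((1 / real (card (Fs n))) * (\<Sum>t\<in>Fs n. f t))))
      + (SUP Fs\<in>{Fs. Folner_seq G Fs}.
        limsup (\<lambda>n. ereal ((1 / real (card (Fs n))) * (\<Sum>t\<in>Fs n. g t))))"
    using Fs by (intro add_mono SUP_upper)
  finally show "limsup (?a (\<lambda>t. f t + g t)) \<le> \<dots>" .
qed

lemma upper_Weyl_mean_sum:
  assumes "finite I"
  shows "upper_Weyl_mean G (\<lambda>t. \<Sum>i\<in>I. f i t) \<le> (\<Sum>i\<in>I. upper_Weyl_mean G (f i))"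
  using assms
proof induction
  case empty
  show ?case
    by (auto simp: upper_Weyl_mean_def Limsup_const intro!: SUP_least)
next
  case (insert i I)
  then show ?case
    using upper_Weyl_mean_add[of G "f i" "\<lambda>t. \<Sum>i\<in>I. f i t"]
    by (auto intro: order_trans add_left_mono)
qed

text \<open>Right translation is injective and commutes with left translation by associativity. It
  therefore carries the symmetric difference of \<open>t <# Fs n\<close> and \<open>Fs n\<close>
  bijectively onto that of the translated sets, and every Folner ratio stays the same.\<close>

lemma (in group) Folner_seq_right_translate:
  assumes Fs: "Folner_seq G Fs" and g: "g \<in> carrier G"
  shows "Folner_seq G (\<lambda>n. (\<lambda>s. s \<otimes> g) ` Fs n)"
proof -
  let ?r = "\<lambda>s. s \<otimes> g"
  have sub: "Fs n \<subseteq> carrier G" for n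
    using Fs by (simp add: Folner_seq_def)
  have inj: "inj_on ?r (carrier G)"
    using g by (auto intro: inj_onI)
  have card: "card (?r ` A) = card A" if "A \<subseteq> carrier G" for A
    using inj that by (meson card_image inj_on_subset)
  have "card (sym_diff (t <# (?r ` Fs n)) (?r ` Fs n)) = card (sym_diff (t <# Fs n) (Fs n))"
    if t: "t \<in> carrier G" for t n
  proof -
    have tsub: "t <# Fs n \<subseteq> carrier G"
      using t sub by (auto simp: l_coset_def)
    have "t <# (?r ` Fs n) = ?r ` (t <# Fs n)"
      using t g sub[of n] by (auto simp: l_coset_def image_UN m_assoc subset_iff)
    then have "sym_diff (t <# (?r ` Fs n)) (?r ` Fs n) = ?r ` sym_diff (t <# Fs n) (Fs n)"
      using inj_on_image_set_diff[OF inj, of "t <# Fs n" "Fs n"]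
        inj_on_image_set_diff[OF inj, of "Fs n" "t <# Fs n"] tsub sub[of n]
      by (simp add: image_Un Diff_subset_conv le_supI2)
    then show ?thesis
      using card[of "sym_diff (t <# Fs n) (Fs n)"] tsub sub[of n] by auto
  qed
  with Fs g show ?thesis
    using card[OF sub] by (auto simp: Folner_seq_def dest: subsetD[OF sub])
qed

text \<open>Averaging \<open>f (t \<otimes> g)\<close> over \<open>Fs n\<close> is averaging
  \<open>f\<close> over the right translate of \<open>Fs n\<close>, which is again a competitor in
  the supremum.\<close>

lemma (in group) upper_Weyl_mean_right_translate:
  assumes g: "g \<in> carrier G"
  shows "upper_Weyl_mean G (\<lambda>t. f (t \<otimes> g)) \<le> upper_Weyl_mean G f"
  unfolding upper_Weyl_mean_def
proof (rule SUP_mono, clarify)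
  fix Fs
  assume Fs: "Folner_seq G Fs"
  let ?Fs = "\<lambda>n. (\<lambda>s. s \<otimes> g) ` Fs n"
  have inj: "inj_on (\<lambda>s. s \<otimes> g) (Fs n)" for n
    using Fs g by (auto intro!: inj_onI simp: Folner_seq_def subset_iff)
  show "\<exists>Fs'\<in>{Fs. Folner_seq G Fs}.
      limsup (\<lambda>n. ereal (1 / real (card (Fs n)) * (\<Sum>t\<in>Fs n. f (t \<otimes> g))))
      \<le> limsup (\<lambda>n. ereal (1 / real (card (Fs' n)) * sum f (Fs' n)))"
    using Folner_seq_right_translate[OF Fs g]
    by (intro bexI[of _ ?Fs]) (simp_all add: card_image[OF inj] sum.reindex[OF inj])
qed

section \<open>Comparison and invariance of \<open>Weyl_D\<close> and
  \<open>Weyl_Dhat\<close>\<close>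

lemma Weyl_D_eq: "Weyl_D G M E F x y = upper_Weyl_mean G (\<lambda>t. dtilde M E F t x y)"
  by (simp add: Weyl_D_def upper_Weyl_mean_def)

lemma Weyl_Dhat_eq:
  assumes "x \<in> fiber E \<omega>" "y \<in> fiber E \<omega>"
  shows "Weyl_Dhat G E F \<omega> x y = upper_Weyl_mean G (\<lambda>t. dist (F t \<omega> x) (F t \<omega> y))"
  using assms by (simp add: Weyl_Dhat_def upper_Weyl_mean_def)

lemma Weyl_Dhat_commute: "Weyl_Dhat G E F \<omega> x y = Weyl_Dhat G E F \<omega> y x"
  by (simp add: Weyl_Dhat_def dist_commute conj_commute)

lemma Weyl_Dhat_triangle:
  assumes "x \<in> fiber E \<omega>" "y \<in> fiber E \<omega>" "z \<in> fiber E \<omega>"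
  shows "Weyl_Dhat G E F \<omega> x z \<le> Weyl_Dhat G E F \<omega> x y + Weyl_Dhat G E F \<omega> y z"
proof -
  have "Weyl_Dhat G E F \<omega> x z
      \<le> upper_Weyl_mean G (\<lambda>t. dist (F t \<omega> x) (F t \<omega> y) + dist (F t \<omega> y) (F t \<omega> z))"
    using assms by (auto simp: Weyl_Dhat_eq dist_triangle intro: upper_Weyl_mean_mono)
  also have "\<dots> \<le> Weyl_Dhat G E F \<omega> x y + Weyl_Dhat G E F \<omega> y z"
    using assms by (simp add: Weyl_Dhat_eq upper_Weyl_mean_add)
  finally show ?thesis .
qed

lemma Weyl_Dhat_le_Weyl_D:
  assumes "finite (space M)" "\<omega> \<in> space M" "x \<in> fiber E \<omega>" "y \<in> fiber E \<omega>"
  shows "Weyl_Dhat G E F \<omega> x y \<le> Weyl_D G M E F x y"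
proof -
  \<comment> \<open>A real \<open>Sup\<close> is an upper bound only of a set that is bounded above;
    finiteness of the base provides this.\<close>
  have "dist (F t \<omega> x) (F t \<omega> y) \<le> dtilde M E F t x y" for t
    unfolding dtilde_def using assms by (intro cSup_upper bdd_above_finite) auto
  then show ?thesis
    using assms by (simp add: Weyl_D_eq Weyl_Dhat_eq upper_Weyl_mean_mono)
qed

text \<open>A supremum of finitely many nonnegative distances is at most their sum, and upper means
  are subadditive. The common fiber makes the set under the \<open>Sup\<close> in
  \<open>dtilde\<close> nonempty, as \<open>cSup_least\<close> requires.\<close>

lemma Weyl_D_le_sum_Weyl_Dhat:
  assumes "finite (space M)" "\<exists>\<omega>\<in>space M. x \<in> fiber E \<omega> \<and> y \<in> fiber E \<omega>"
  shows "Weyl_D G M E F x y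
    \<le> (\<Sum>\<omega> | \<omega> \<in> space M \<and> x \<in> fiber E \<omega> \<and> y \<in> fiber E \<omega>. Weyl_Dhat G E F \<omega> x y)"
proof -
  let ?I = "{\<omega> \<in> space M. x \<in> fiber E \<omega> \<and> y \<in> fiber E \<omega>}"
  have "dtilde M E F t x y \<le> (\<Sum>\<omega>\<in>?I. dist (F t \<omega> x) (F t \<omega> y))" for t
    unfolding dtilde_def using assms
    by (intro cSup_least) (auto intro!: member_le_sum[where f = "\<lambda>\<omega>. dist (F t \<omega> x) (F t \<omega> y)"])
  then have "Weyl_D G M E F x y
      \<le> upper_Weyl_mean G (\<lambda>t. \<Sum>\<omega>\<in>?I. dist (F t \<omega> x) (F t \<omega> y))"
    by (simp add: Weyl_D_eq upper_Weyl_mean_mono)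
  also have "\<dots> \<le> (\<Sum>\<omega>\<in>?I. upper_Weyl_mean G (\<lambda>t. dist (F t \<omega> x) (F t \<omega> y)))"
    using assms by (intro upper_Weyl_mean_sum) simp
  also have "\<dots> = (\<Sum>\<omega>\<in>?I. Weyl_Dhat G E F \<omega> x y)"
    by (intro sum.cong) (auto simp: Weyl_Dhat_eq)
  finally show ?thesis .
qed

text \<open>By the cocycle rule, \<open>F t \<omega>\<close> is
  \<open>F (t \<otimes> inv g) (act g \<omega>)\<close> after \<open>F g \<omega>\<close>. The
  distances on the left are thus a right translate of those on the right. This direction is the one
  that pulls smallness back along \<open>g\<close>.\<close>

lemma (in bundle_RDS) Weyl_Dhat_le_image:
  assumes g: "g \<in> carrier G" and \<omega>: "\<omega> \<in> space M" and xy: "x \<in> fiber E \<omega>" "y \<in> fiber E \<omega>"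
  shows "Weyl_Dhat G E F \<omega> x y \<le> Weyl_Dhat G E F (act g \<omega>) (F g \<omega> x) (F g \<omega> y)"
proof -
  interpret group G
    using group_hom group_hom.axioms(1) by blast
  let ?f = "\<lambda>t. dist (F t (act g \<omega>) (F g \<omega> x)) (F t (act g \<omega>) (F g \<omega> y))"
  have "dist (F t \<omega> x) (F t \<omega> y) = ?f (t \<otimes> inv g)" if "t \<in> carrier G" for t
    using that g \<omega> xy by (simp add: F_cocycle m_assoc)
  then have "Weyl_Dhat G E F \<omega> x y \<le> upper_Weyl_mean G (\<lambda>t. ?f (t \<otimes> inv g))"
    using xy by (auto simp: Weyl_Dhat_eq intro: upper_Weyl_mean_mono)
  also have "\<dots> \<le> upper_Weyl_mean G ?f"
    using g by (intro upper_Weyl_mean_right_translate) simp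
  finally show ?thesis
    using assms by (simp add: Weyl_Dhat_eq F_fiber)
qed

section \<open>Points of a finite base as measurable atoms\<close>

lemma (in bundle_RDS) E_subset: "E \<subseteq> space M \<times> UNIV"
  using sets.sets_into_space[OF E_sets] by (simp add: space_pair_measure)

text \<open>Each other point is separated from \<open>x\<close> by a measurable set, complemented if
  necessary, and finitely many of these sets cut out \<open>x\<close>. Writing the intersection as
  the complement of a union also covers a one-point space.\<close>

lemma singleton_sets_if_countably_separated:
  assumes cs: "countably_separated M" and fin: "finite (space M)" and x: "x \<in> space M"
  shows "{x} \<in> sets M"
proof -
  have "\<exists>C\<in>sets M. x \<in> C \<and> y \<notin> C" if y: "y \<in> space M - {x}" for y
  proof -
    obtain C where "C \<in> sets M" "x \<in> C \<longleftrightarrow> y \<notin> C"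
      using cs x y unfolding countably_separated_def by blast
    then show ?thesis
      using x y by (cases "x \<in> C") (auto intro: bexI[of _ "space M - C"])
  qed
  then obtain C where C: "\<And>y. y \<in> space M - {x} \<Longrightarrow> C y \<in> sets M \<and> x \<in> C y \<and> y \<notin> C y"
    by metis
  have "space M - (\<Union>y\<in>space M - {x}. space M - C y) \<in> sets M"
    using fin C by (intro sets.Diff sets.top sets.finite_UN) auto
  also have "space M - (\<Union>y\<in>space M - {x}. space M - C y) = {x}"
    using C x by blast
  finally show ?thesis .
qed

lemma AE_atom:
  assumes "AE x in M. P x" "{a} \<in> sets M" "emeasure M {a} \<noteq> 0"
  shows "P a"
proof (rule ccontr)
  assume "\<not> P a"
  moreover obtain N where "{x \<in> space M. \<not> P x} \<subseteq> N" "emeasure M N = 0" "N \<in> sets M"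
    using assms(1) by (rule AE_E)
  moreover have "a \<in> space M"
    using assms(2) sets.sets_into_space by blast
  ultimately have "emeasure M {a} \<le> 0"
    using emeasure_mono[of "{a}" N M] by auto
  with assms(3) show False by simp
qed

lemma minimal_actionD:
  assumes "minimal_action G T \<phi>" "closedin T A" "\<And>g. g \<in> carrier G \<Longrightarrow> \<phi> g ` A \<subseteq> A" "a \<in> A"
  shows "A = topspace T"
  using assms unfolding minimal_action_def by blast

section \<open>Consequences of minimality over a finite base\<close>

locale finite_minimal_RDS = continuous_bundle_RDS +
  assumes finite_base: "finite (space M)"
    and minimal: "minimal_action G (bundle_topology M E) (skew_product act F)"
begin

lemma fiber_in_space: "x \<in> fiber E \<omega> \<Longrightarrow> \<omega> \<in> space M"
  using E_subset by (auto simp: fiber_def)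

text \<open>This is minimality in fiberwise form. Over a finite discrete base, one closed set per
  base point glues to a closed subset of the product. The sets \<open>C \<omega>\<close> may extend
  beyond the fibers, so the glued set is intersected with \<open>E\<close>, and invariance is asked
  only there.\<close>

lemma closed_invariant_eq_all:
  assumes closed: "\<And>\<omega>. \<omega> \<in> space M \<Longrightarrow> closed (C \<omega>)"
    and inv: "\<And>g \<omega> x. \<lbrakk>g \<in> carrier G; x \<in> fiber E \<omega>; x \<in> C \<omega>\<rbrakk> \<Longrightarrow> F g \<omega> x \<in> C (act g \<omega>)"
    and ne: "x \<in> fiber E \<omega>" "x \<in> C \<omega>"
    and y: "y \<in> fiber E \<nu>"
  shows "y \<in> C \<nu>"
proof -
  let ?T = "prod_topology (discrete_topology (space M)) (euclidean :: 'd topology)"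
  let ?B = "\<Union>\<omega>\<in>space M. {\<omega>} \<times> C \<omega>"
  have "closedin ?T ?B"
    using finite_base closed by (intro closedin_Union) (auto simp: closedin_prod_Times_iff)
  then have closedin: "closedin (bundle_topology M E) (E \<inter> ?B)"
    unfolding bundle_topology_def by (auto simp: closedin_subtopology)
  have image: "skew_product act F g ` (E \<inter> ?B) \<subseteq> E \<inter> ?B" if g: "g \<in> carrier G" for g
  proof -
    have "(act g \<omega>, F g \<omega> x) \<in> E \<inter> ?B" if "(\<omega>, x) \<in> E \<inter> ?B" for \<omega> x
      using that g F_fiber[OF g] inv[OF g] element_image[OF g] by (auto simp: fiber_def)
    then show ?thesis
      by (auto simp: skew_product_def)
  qed
  have mem: "(\<omega>, x) \<in> E \<inter> ?B"
    using ne fiber_in_space by (auto simp: fiber_def)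
  have topspace: "topspace (bundle_topology M E) = E"
    using E_subset by (auto simp: bundle_topology_def)
  have "E \<inter> ?B = E"
    using minimal_actionD[OF minimal closedin image mem] topspace by simp
  with y show ?thesis
    by (auto simp: fiber_def)
qed

lemma singleton_sets:
  "\<omega> \<in> space M \<Longrightarrow> {\<omega>} \<in> sets M"
  using lebesgue finite_base
  by (simp add: lebesgue_prob_space_def singleton_sets_if_countably_separated)

text \<open>Since \<open>act g\<close> is injective and preserves the measure, the base points of
  positive mass form an invariant set.\<close>

lemma emeasure_singleton_act:
  assumes "g \<in> carrier G" "\<omega> \<in> space M"
  shows "emeasure M {act g \<omega>} = emeasure M {\<omega>}"
proof -
  have "emeasure M {act g \<omega>} = emeasure (distr M M (act g)) {act g \<omega>}"
    by (simp add: assms measure_preserving)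
  also have "\<dots> = emeasure M (act g -` {act g \<omega>} \<inter> space M)"
    using measurable_act[OF assms(1)] singleton_sets[OF element_image[OF assms refl]]
    by (rule emeasure_distr)
  also have "act g -` {act g \<omega>} \<inter> space M = {\<omega>}"
    using assms inj_prop[OF assms(1)] by (auto dest: inj_onD)
  finally show ?thesis .
qed

lemma exists_atom:
  obtains \<omega> where "\<omega> \<in> space M" "emeasure M {\<omega>} \<noteq> 0"
proof -
  have "prob_space M"
    using lebesgue by (simp add: lebesgue_prob_space_def)
  then have "(\<Sum>\<omega>\<in>space M. emeasure M {\<omega>}) = 1"
    using finite_base singleton_sets
    by (simp add: emeasure_eq_sum_singleton[symmetric] prob_space.emeasure_space_1)
  then show ?thesis
    using that by (metis sum.neutral zero_neq_one)
qed

text \<open>An empty bundle would count as minimal and be vacuously both equicontinuous and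
  sensitive. An atom, where the almost sure assumption must hold, rules this out.\<close>

lemma E_nonempty: obtains \<omega> x where "x \<in> fiber E \<omega>"
  using exists_atom AE_atom[OF AE_continuous singleton_sets] by (metis all_not_in_conv)

text \<open>The continuity assumption holds only almost everywhere, but the base points of positive mass
  carry a closed invariant part of the bundle.\<close>

lemma compact_continuous_fiber:
  assumes "x \<in> fiber E \<omega>"
  shows "compact (fiber E \<omega>)" "g \<in> carrier G \<Longrightarrow> continuous_on (fiber E \<omega>) (F g \<omega>)"
proof -
  obtain \<nu> where \<nu>: "\<nu> \<in> space M" "emeasure M {\<nu>} \<noteq> 0"
    by (rule exists_atom)
  obtain y where y: "y \<in> fiber E \<nu>"
    using AE_atom[OF AE_continuous singleton_sets] \<nu> by blast
  \<comment> \<open>The closed set over a base point is everything or nothing, according to whether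
    that point has mass. The point \<open>y\<close> over the atom starts the argument, which then
    forces mass on the base point of \<open>x\<close>.\<close>
  have "x \<in> (if emeasure M {\<omega>} = 0 then {} else UNIV)"
    by (rule closed_invariant_eq_all[OF _ _ y _ assms])
      (use \<nu> in \<open>auto simp: emeasure_singleton_act fiber_in_space split: if_splits\<close>)
  then have "emeasure M {\<omega>} \<noteq> 0"
    by auto
  then show "compact (fiber E \<omega>)" "g \<in> carrier G \<Longrightarrow> continuous_on (fiber E \<omega>) (F g \<omega>)"
    using AE_atom[OF AE_continuous singleton_sets] fiber_in_space[OF assms] by blast+
qed

lemma closed_fiber: "closed (fiber E \<omega>)"
  using compact_continuous_fiber(1) by (cases "fiber E \<omega> = {}") (auto intro: compact_imp_closed)

text \<open>The points whose orbits never enter the \<open>\<epsilon>\<close>-ball about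
  \<open>x\<close> in the fiber over \<open>\<omega>\<close> form a closed invariant set. It misses
  \<open>x\<close> itself because of the neutral element, so by minimality it is empty.\<close>

lemma orbit_visits_ball:
  assumes x: "x \<in> fiber E \<omega>" and z: "z \<in> fiber E \<nu>" and \<epsilon>: "\<epsilon> > 0"
  obtains g where "g \<in> carrier G" "act g \<nu> = \<omega>" "dist x (F g \<nu> z) < \<epsilon>"
proof -
  interpret group G
    using group_hom group_hom.axioms(1) by blast
  \<comment> \<open>If no group element moves \<open>\<nu>\<close> to \<open>\<omega>\<close>, this
    intersection is the whole space, which is closed as well.\<close>
  let ?C = "\<lambda>\<nu>. \<Inter>g\<in>{g\<in>carrier G. act g \<nu> = \<omega>}. {z \<in> fiber E \<nu>. \<epsilon> \<le> dist x (F g \<nu> z)}"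
  have closed: "closed (?C \<nu>)" for \<nu>
  proof (intro closed_INT ballI)
    fix g assume "g \<in> {g\<in>carrier G. act g \<nu> = \<omega>}"
    then have "continuous_on (fiber E \<nu>) (F g \<nu>)"
      using compact_continuous_fiber(2) by (cases "fiber E \<nu> = {}") auto
    then have "closed (fiber E \<nu> \<inter> F g \<nu> -` (- ball x \<epsilon>))"
      by (intro continuous_closed_preimage closed_fiber) auto
    also have "fiber E \<nu> \<inter> F g \<nu> -` (- ball x \<epsilon>) = {z \<in> fiber E \<nu>. \<epsilon> \<le> dist x (F g \<nu> z)}"
      by auto
    finally show "closed {z \<in> fiber E \<nu>. \<epsilon> \<le> dist x (F g \<nu> z)}" .
  qed
  have inv: "F h \<nu> y \<in> ?C (act h \<nu>)"
    if h: "h \<in> carrier G" and y: "y \<in> fiber E \<nu>" "y \<in> ?C \<nu>" for h \<nu> y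
  proof -
    have \<nu>: "\<nu> \<in> space M"
      using y(1) by (rule fiber_in_space)
    have "\<epsilon> \<le> dist x (F g (act h \<nu>) (F h \<nu> y))" if g: "g \<in> carrier G" "act g (act h \<nu>) = \<omega>" for g
    proof -
      have "act (g \<otimes> h) \<nu> = \<omega>"
        using g h \<nu> by (simp add: composition_rule)
      then show ?thesis
        using g h \<nu> y by (simp add: F_cocycle)
    qed
    then show ?thesis
      using F_fiber[OF h \<nu> y(1)] by simp
  qed
  have "x \<notin> ?C \<omega>"
  proof
    assume "x \<in> ?C \<omega>"
    moreover have "act \<one> \<omega> = \<omega>"
      using id_eq_one fiber_in_space[OF x] by (metis restrict_apply)
    ultimately have "\<epsilon> \<le> dist x (F \<one> \<omega> x)"
      by simp
    then show False
      using \<epsilon> F_one[OF fiber_in_space[OF x] x] by simp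
  qed
  then have "z \<notin> ?C \<nu>"
    using closed_invariant_eq_all[of ?C, OF closed inv z _ x] by blast
  then show ?thesis
    using z that by (auto simp: not_le)
qed

text \<open>This makes the convention \<open>Weyl_Dhat = \<infinity>\<close> off the fibers irrelevant for sensitivity.\<close>

lemma fibers_near:
  obtains \<epsilon> where "\<epsilon> > 0" "\<And>\<omega> y. y \<in> fiber E \<omega> \<Longrightarrow> dist x y < \<epsilon> \<Longrightarrow> x \<in> fiber E \<omega>"
proof -
  \<comment> \<open>Only finitely many closed fibers miss \<open>x\<close>, so some ball about
    \<open>x\<close> avoids them all.\<close>
  have "closed (\<Union>\<omega>\<in>{\<omega>\<in>space M. x \<notin> fiber E \<omega>}. fiber E \<omega>)"
    using finite_base closed_fiber by (intro closed_UN) auto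
  then have "open (- (\<Union>\<omega>\<in>{\<omega>\<in>space M. x \<notin> fiber E \<omega>}. fiber E \<omega>))"
    by (rule open_Compl)
  moreover have "x \<in> - (\<Union>\<omega>\<in>{\<omega>\<in>space M. x \<notin> fiber E \<omega>}. fiber E \<omega>)"
    by simp
  ultimately obtain \<epsilon> where \<epsilon>: "\<epsilon> > 0"
    "ball x \<epsilon> \<subseteq> - (\<Union>\<omega>\<in>{\<omega>\<in>space M. x \<notin> fiber E \<omega>}. fiber E \<omega>)"
    by (rule openE)
  have "x \<in> fiber E \<omega>" if "y \<in> fiber E \<omega>" "dist x y < \<epsilon>" for \<omega> y
    using subsetD[OF \<epsilon>(2), of y] that fiber_in_space by auto
  with \<epsilon>(1) show ?thesis
    by (rule that)
qed

section \<open>Equicontinuity versus sensitivity\<close>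

lemma not_equicontinuous_and_sensitive:
  "\<not> (Weyl_mean_equicontinuous G M E F \<and> Weyl_mean_sensitive G M E F)"
proof
  assume *: "Weyl_mean_equicontinuous G M E F \<and> Weyl_mean_sensitive G M E F"
  obtain x \<nu> where x: "x \<in> fiber E \<nu>"
    by (rule E_nonempty)
  obtain \<delta> where \<delta>: "\<delta> > 0"
    "\<And>\<epsilon>. \<epsilon> > 0 \<Longrightarrow> \<exists>\<omega>\<in>space M. \<exists>y\<in>fiber E \<omega> \<inter> ball x \<epsilon>. Weyl_Dhat G E F \<omega> x y > ereal \<delta>"
    using * x fiber_in_space[OF x] unfolding Weyl_mean_sensitive_def by blast
  obtain r where r: "r > 0"
    "\<And>\<omega> y. \<omega> \<in> space M \<Longrightarrow> x \<in> fiber E \<omega> \<Longrightarrow> y \<in> fiber E \<omega> \<Longrightarrow> dist x y < r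
      \<Longrightarrow> Weyl_D G M E F x y < ereal \<delta>"
    using *[THEN conjunct1, unfolded Weyl_mean_equicontinuous_def, rule_format, OF \<delta>(1)] by metis
  obtain \<epsilon> where \<epsilon>: "\<epsilon> > 0" "\<And>\<omega> y. y \<in> fiber E \<omega> \<Longrightarrow> dist x y < \<epsilon> \<Longrightarrow> x \<in> fiber E \<omega>"
    using fibers_near[of x] by blast
  \<comment> \<open>Radius \<open>r\<close> brings equicontinuity into play. Radius
    \<open>\<epsilon>\<close> puts \<open>x\<close> into the fiber of \<open>y\<close>, so that the
    large value of \<open>Weyl_Dhat\<close> is a genuine mean and not the conventional
    infinity.\<close>
  obtain \<omega> y where y: "\<omega> \<in> space M" "y \<in> fiber E \<omega>" "dist x y < min r \<epsilon>"
    "Weyl_Dhat G E F \<omega> x y > ereal \<delta>"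
    using \<delta>(2)[of "min r \<epsilon>"] r(1) \<epsilon>(1) by auto
  then have "x \<in> fiber E \<omega>"
    using \<epsilon>(2) by simp
  then have "Weyl_Dhat G E F \<omega> x y < ereal \<delta>"
    using r(2) y Weyl_Dhat_le_Weyl_D[OF finite_base] by (metis min_less_iff_conj order_le_less_trans)
  with y(4) show False
    by simp
qed

text \<open>Failure of sensitivity at the constant \<open>\<eta> / 2\<close> yields one ball, about
  some \<open>x\<close>, of points close to \<open>x\<close> in mean. An element \<open>g\<close>
  moving \<open>z\<close> into this ball pulls it back to a neighbourhood of \<open>z\<close>. The
  triangle inequality through the centre \<open>x\<close> costs the factor 2.\<close>

lemma Weyl_Dhat_locally_small:
  assumes not_sensitive: "\<not> Weyl_mean_sensitive G M E F"
    and \<eta>: "\<eta> > 0" and z: "z \<in> fiber E \<nu>"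
  obtains r where "r > 0"
    "\<And>u v. \<lbrakk>u \<in> fiber E \<nu> \<inter> ball z r; v \<in> fiber E \<nu> \<inter> ball z r\<rbrakk>
      \<Longrightarrow> Weyl_Dhat G E F \<nu> u v \<le> ereal \<eta>"
proof -
  have "\<exists>x\<in>\<Union>\<omega>\<in>space M. fiber E \<omega>. \<exists>\<epsilon>>0. \<forall>\<omega>\<in>space M. \<forall>y\<in>fiber E \<omega> \<inter> ball x \<epsilon>.
      Weyl_Dhat G E F \<omega> x y \<le> ereal (\<eta> / 2)"
    using not_sensitive half_gt_zero[OF \<eta>] unfolding Weyl_mean_sensitive_def not_less[symmetric]
    by metis
  then obtain x \<omega> \<epsilon> where x: "x \<in> fiber E \<omega>" and \<epsilon>: "\<epsilon> > 0"
    and small: "\<And>y. y \<in> fiber E \<omega> \<inter> ball x \<epsilon> \<Longrightarrow> Weyl_Dhat G E F \<omega> x y \<le> ereal (\<eta> / 2)"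
    using fiber_in_space by blast
  obtain g where g: "g \<in> carrier G" "act g \<nu> = \<omega>" "dist x (F g \<nu> z) < \<epsilon>"
    using orbit_visits_ball[OF x z \<epsilon>] .
  have "openin (top_of_set (fiber E \<nu>)) (fiber E \<nu> \<inter> F g \<nu> -` ball x \<epsilon>)"
    using compact_continuous_fiber(2)[OF z g(1)] by (rule continuous_openin_preimage_gen) simp
  moreover have "z \<in> fiber E \<nu> \<inter> F g \<nu> -` ball x \<epsilon>"
    using z g(3) by simp
  ultimately obtain r where r: "r > 0" "ball z r \<inter> fiber E \<nu> \<subseteq> F g \<nu> -` ball x \<epsilon>"
    unfolding openin_contains_ball by blast
  have "Weyl_Dhat G E F \<nu> u v \<le> ereal \<eta>"
    if u: "u \<in> fiber E \<nu> \<inter> ball z r" and v: "v \<in> fiber E \<nu> \<inter> ball z r" for u v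
  proof -
    have \<nu>: "\<nu> \<in> space M"
      using z by (rule fiber_in_space)
    let ?u = "F g \<nu> u" and ?v = "F g \<nu> v"
    have uv: "?u \<in> fiber E \<omega> \<inter> ball x \<epsilon>" "?v \<in> fiber E \<omega> \<inter> ball x \<epsilon>"
      using F_fiber[OF g(1) \<nu>] u v r(2) g(2) by auto
    have "Weyl_Dhat G E F \<nu> u v \<le> Weyl_Dhat G E F \<omega> ?u ?v"
      using Weyl_Dhat_le_image[OF g(1) \<nu>] u v g(2) by auto
    also have "\<dots> \<le> Weyl_Dhat G E F \<omega> ?u x + Weyl_Dhat G E F \<omega> x ?v"
      using uv x by (intro Weyl_Dhat_triangle) auto
    also have "\<dots> \<le> ereal (\<eta> / 2) + ereal (\<eta> / 2)"
      using uv small by (intro add_mono) (auto simp: Weyl_Dhat_commute[of G E F \<omega> ?u])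
    finally show ?thesis
      by simp
  qed
  with r(1) show ?thesis
    using that by blast
qed

text \<open>A Lebesgue number \<open>\<delta>\<close> for the cover of the compact fiber by the
  balls of local smallness works: points closer than \<open>\<delta>\<close> share a ball. The empty
  fiber is split off because compactness is derived from a point of the fiber.\<close>

lemma Weyl_Dhat_uniformly_small:
  assumes not_sensitive: "\<not> Weyl_mean_sensitive G M E F" and \<eta>: "\<eta> > 0"
  obtains \<delta> where "\<delta> > 0"
    "\<And>x y. \<lbrakk>x \<in> fiber E \<nu>; y \<in> fiber E \<nu>; dist x y < \<delta>\<rbrakk> \<Longrightarrow> Weyl_Dhat G E F \<nu> x y \<le> ereal \<eta>"
proof (cases "fiber E \<nu> = {}")
  case True
  then show ?thesis
    using that[of 1] by simp
next
  case False
  have "\<exists>r>0. \<forall>u\<in>fiber E \<nu> \<inter> ball z r. \<forall>v\<in>fiber E \<nu> \<inter> ball z r.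
      Weyl_Dhat G E F \<nu> u v \<le> ereal \<eta>" if "z \<in> fiber E \<nu>" for z
    using Weyl_Dhat_locally_small[OF not_sensitive \<eta> that] by metis
  then obtain r where r: "\<And>z. z \<in> fiber E \<nu> \<Longrightarrow> r z > 0"
    "\<And>z u v. \<lbrakk>z \<in> fiber E \<nu>; u \<in> fiber E \<nu> \<inter> ball z (r z); v \<in> fiber E \<nu> \<inter> ball z (r z)\<rbrakk>
      \<Longrightarrow> Weyl_Dhat G E F \<nu> u v \<le> ereal \<eta>"
    by metis
  have "compact (fiber E \<nu>)"
    using False compact_continuous_fiber(1) by blast
  moreover have "fiber E \<nu> \<subseteq> \<Union>((\<lambda>z. ball z (r z)) ` fiber E \<nu>)"
    using r(1) by force
  ultimately obtain \<delta> where \<delta>: "\<delta> > 0"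
    "\<And>x. x \<in> fiber E \<nu> \<Longrightarrow> \<exists>B\<in>(\<lambda>z. ball z (r z)) ` fiber E \<nu>. ball x \<delta> \<subseteq> B"
    by (rule Heine_Borel_lemma) auto
  have "Weyl_Dhat G E F \<nu> x y \<le> ereal \<eta>"
    if xy: "x \<in> fiber E \<nu>" "y \<in> fiber E \<nu>" "dist x y < \<delta>" for x y
  proof -
    obtain z where z: "z \<in> fiber E \<nu>" "ball x \<delta> \<subseteq> ball z (r z)"
      using \<delta>(2)[OF xy(1)] by blast
    have "x \<in> ball x \<delta>" "y \<in> ball x \<delta>"
      using \<delta>(1) xy(3) by auto
    then show ?thesis
      using z(2) xy by (intro r(2)[OF z(1)] IntI) blast+
  qed
  with \<delta>(1) show ?thesis
    using that by blast
qed

lemma equicontinuous_if_not_sensitive: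
  assumes "\<not> Weyl_mean_sensitive G M E F"
  shows "Weyl_mean_equicontinuous G M E F"
  unfolding Weyl_mean_equicontinuous_def
proof (intro allI impI)
  fix \<epsilon> :: real
  assume \<epsilon>: "\<epsilon> > 0"
  \<comment> \<open>At most \<open>card (space M)\<close> fibers contain both points, each
    contributing at most \<open>\<eta>\<close>; the extra 1 makes the final bound strict and avoids
    division by zero.\<close>
  define \<eta> where "\<eta> = \<epsilon> / (real (card (space M)) + 1)"
  have \<eta>: "\<eta> > 0"
    using \<epsilon> by (simp add: \<eta>_def)
  have "\<exists>\<delta>>0. \<forall>x y. x \<in> fiber E \<nu> \<longrightarrow> y \<in> fiber E \<nu> \<longrightarrow> dist x y < \<delta>
      \<longrightarrow> Weyl_Dhat G E F \<nu> x y \<le> ereal \<eta>" for \<nu>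
    by (rule Weyl_Dhat_uniformly_small[OF assms \<eta>, of \<nu>]) blast
  then obtain \<delta> where \<delta>: "\<And>\<nu>. \<delta> \<nu> > 0"
    "\<And>\<nu> x y. \<lbrakk>x \<in> fiber E \<nu>; y \<in> fiber E \<nu>; dist x y < \<delta> \<nu>\<rbrakk>
      \<Longrightarrow> Weyl_Dhat G E F \<nu> x y \<le> ereal \<eta>"
    by metis
  \<comment> \<open>Two points may share several fibers, and all of these enter the sum bounding
    \<open>Weyl_D\<close>, so one radius has to serve every base point.\<close>
  let ?\<delta> = "Min (\<delta> ` space M)"
  have ne: "space M \<noteq> {}"
    using exists_atom by blast
  show "\<exists>\<delta>>0. \<forall>x y. (\<exists>\<omega>\<in>space M. x \<in> fiber E \<omega> \<and> y \<in> fiber E \<omega>) \<and> dist x y < \<delta>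
      \<longrightarrow> Weyl_D G M E F x y < ereal \<epsilon>"
  proof (intro exI[of _ ?\<delta>] conjI allI impI)
    show "?\<delta> > 0"
      using \<delta>(1) finite_base ne by simp
    fix x y
    assume xy: "(\<exists>\<omega>\<in>space M. x \<in> fiber E \<omega> \<and> y \<in> fiber E \<omega>) \<and> dist x y < ?\<delta>"
    let ?I = "{\<omega> \<in> space M. x \<in> fiber E \<omega> \<and> y \<in> fiber E \<omega>}"
    have close: "dist x y < \<delta> \<omega>" if "\<omega> \<in> space M" for \<omega>
      using xy that finite_base ne by (simp add: Min_gr_iff)
    have "Weyl_D G M E F x y \<le> (\<Sum>\<omega>\<in>?I. Weyl_Dhat G E F \<omega> x y)"
      using xy finite_base by (intro Weyl_D_le_sum_Weyl_Dhat) auto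
    also have "\<dots> \<le> (\<Sum>\<omega>\<in>?I. ereal \<eta>)"
      using close by (intro sum_mono \<delta>(2)) auto
    also have "\<dots> = ereal (real (card ?I) * \<eta>)"
      by simp
    also have "real (card ?I) * \<eta> < \<epsilon>"
    proof -
      have "card ?I \<le> card (space M)"
        using finite_base by (intro card_mono) auto
      then have "real (card ?I) * \<eta> < (real (card (space M)) + 1) * \<eta>"
        using \<eta> by (intro mult_strict_right_mono) auto
      then show ?thesis
        by (simp add: \<eta>_def add_nonneg_pos less_imp_neq[symmetric])
    qed
    finally show "Weyl_D G M E F x y < ereal \<epsilon>"
      by simp
  qed
qed

end

theorem corollary5p1:
  fixes G :: "('g, 'm) monoid_scheme"
    and M :: "'w measure"
    and act :: "'g \<Rightarrow> 'w \<Rightarrow> 'w"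
    and E :: "('w \<times> 'x::metric_space) set"
    and F :: "'g \<Rightarrow> 'w \<Rightarrow> 'x \<Rightarrow> 'x"
  assumes "group G" and "countable (carrier G)" and "amenable G"
    and "continuous_bundle_RDS G M act E F"
    and "finite (space M)"
    and "minimal_action G (bundle_topology M E) (skew_product act F)"
  shows "(Weyl_mean_equicontinuous G M E F \<or> Weyl_mean_sensitive G M E F) \<and>
         \<not> (Weyl_mean_equicontinuous G M E F \<and> Weyl_mean_sensitive G M E F)"
proof -
  interpret continuous_bundle_RDS G M act E F
    by fact
  interpret finite_minimal_RDS G M act E F
    by unfold_locales fact+
  show ?thesis
    using equicontinuous_if_not_sensitive not_equicontinuous_and_sensitive by blast
qed

end
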